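(* Let $d>0$, $\omega>0$, and let $g:\mathbb{R}\to\mathbb{R}$ be an even, $d$-periodic function, integrable over a period. For $n\in\mathbb{Z}$ put $k_n=\frac{2\pi}{d}n$ and $\hat g_n=\frac{2}{d}\int_0^{d/2} g(x)\cos(k_n x)\,dx$. For $t\ge 0$, $z>0$, $x\in\mathbb{R}$ let $$u(t,x,z)=\sum_{n\in\mathbb{Z}}\hat g_n\left(\sin\omega(t-z)-k_n z\int_z^t\frac{J_1\left(k_n\sqrt{\tau^2-z^2}\right)}{\sqrt{\tau^2-z^2}}\,\sin\omega(t-\tau)\,d\tau\right)\theta(t-z)\cos(k_n x),$$ and let $$U(x,z)=\sum_{n\in\mathbb{Z}}\hat g_n\cos(k_n x)\times\begin{cases}\exp\left(-iz\sqrt{\omega^2-k_n^2}\right), & 0\le |k_n|\le\omega,\\ \exp\left(-z\sqrt{k_n^2-\omega^2}\right), & \omega<|k_n|<\infty.\end{cases}$$ Then for every $x\in\mathbb{R}$ and every $z>0$, $$\lim_{t\to\infty}\left(u(t,x,z)-\operatorname{Im}\left[U(x,z)e^{i\omega t}\right]\right)=0.$$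
   Context: $J_1$ denotes the Bessel function of the first kind of order $1$, and $\theta$ is the Heaviside step function. The function $g$ is the profile of a diffraction grating of period $d$ located at $z=0$, and $\omega$ is the frequency of the light source, which is switched on at $t=0$. The function $u$ is the paper's solution of the wave problem $\partial_{tt}u=\partial_{xx}u+\partial_{zz}u$ for $t>0$, $z>0$, with $u=\partial_t u=0$ at $t=0$, $\partial_x u=0$ at $x=0$ and at $x=d/2$, $u(t,x,0)=g(x)\sin(\omega t)\,\theta(t)$, and $u$ bounded as $z\to\infty$. The function $U$ is the corresponding solution of the Helmholtz equation. In the claim, $u$ and $U$ are the functions defined by the displayed series. *)

theory Defs
  imports "HOL-Analysis.Analysis"
begin

definition bessel_J :: "nat \<Rightarrow> real \<Rightarrow> real" where
  "bessel_J \<nu> x = (\<Sum>m. (-1) ^ m / (fact m * fact (m + \<nu>)) * (x / 2) ^ (2 * m + \<nu>))"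

(* The value at 0 is a convention; it plays no role in limits as t tends to infinity. *)
definition heaviside :: "real \<Rightarrow> real" where
  "heaviside s = (if s \<ge> 0 then 1 else 0)"

definition wavenumber :: "real \<Rightarrow> int \<Rightarrow> real" where
  "wavenumber d n = 2 * pi / d * of_int n"

definition cos_coeff :: "real \<Rightarrow> (real \<Rightarrow> real) \<Rightarrow> int \<Rightarrow> real" where
  "cos_coeff d g n = 2 / d * integral {0..d/2} (\<lambda>x. g x * cos (wavenumber d n * x))"

(* At the endpoint \<tau> = z the integrand below is 0 / 0 = 0 instead of its limit
   (k_n / 2) * sin (\<omega> (t - z)); a single point does not affect the integral.
   For t < z the interval is empty and the integral is 0. *)
definition wave_term ::
    "real \<Rightarrow> real \<Rightarrow> (real \<Rightarrow> real) \<Rightarrow> real \<Rightarrow> real \<Rightarrow> real \<Rightarrow> int \<Rightarrow> real" where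
  "wave_term d \<omega> g t x z n =
     cos_coeff d g n *
     (sin (\<omega> * (t - z)) -
      wavenumber d n * z *
        integral {z..t} (\<lambda>\<tau>. bessel_J 1 (wavenumber d n * sqrt (\<tau>\<^sup>2 - z\<^sup>2)) / sqrt (\<tau>\<^sup>2 - z\<^sup>2)
                            * sin (\<omega> * (t - \<tau>)))) *
     heaviside (t - z) * cos (wavenumber d n * x)"

definition wave_sol ::
    "real \<Rightarrow> real \<Rightarrow> (real \<Rightarrow> real) \<Rightarrow> real \<Rightarrow> real \<Rightarrow> real \<Rightarrow> real" where
  "wave_sol d \<omega> g t x z = (\<Sum>\<^sub>\<infinity>n\<in>UNIV. wave_term d \<omega> g t x z n)"

definition helmholtz_factor :: "real \<Rightarrow> real \<Rightarrow> real \<Rightarrow> complex" where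
  "helmholtz_factor \<omega> k z =
     (if \<bar>k\<bar> \<le> \<omega> then exp (- \<i> * of_real z * of_real (sqrt (\<omega>\<^sup>2 - k\<^sup>2)))
      else of_real (exp (- z * sqrt (k\<^sup>2 - \<omega>\<^sup>2))))"

definition helmholtz_sol ::
    "real \<Rightarrow> real \<Rightarrow> (real \<Rightarrow> real) \<Rightarrow> real \<Rightarrow> real \<Rightarrow> complex" where
  "helmholtz_sol d \<omega> g x z =
     (\<Sum>\<^sub>\<infinity>n\<in>UNIV. of_real (cos_coeff d g n * cos (wavenumber d n * x)) *
                  helmholtz_factor \<omega> (wavenumber d n) z)"

end

theory Submission
  imports Defs
begin

text \<open>
  Up to the factor g_n cos(k_n x), the n-th mode of u is the imaginary part of exp(i\<omega>t) G_t(p, k) at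
  p = i\<omega>, k = k_n, where G_t(p, k) = exp(-pz) - kz \<integral> J_1(ks)/s exp(-p\<tau>) d\<tau> with s^2 = \<tau>^2 - z^2 and \<tau>
  running over [z, t]. Along a curve p^2 + k^2 = P the integrand of dG_t/dp is an exact derivative in
  \<tau>, and dG_t/dp = -z J_0(k sqrt(t^2 - z^2)) exp(-pt). Moving p from i\<omega> along the imaginary and
  then the real half-axis to the point where k vanishes therefore changes G_t by a quantity that tends
  to 0 as t grows. At the end point G_t = exp(-pz) with p^2 = k_n^2 - \<omega>^2, which is the Helmholtz
  factor; the path selects the branch of the square root.
  Two integrations by parts and the decay of J_1 bound the n-th mode by a multiple of
  |k_n|^(-3/2) uniformly in t, so the limit may be taken term by term.
\<close>

section \<open>Bessel-Clifford functions: series, derivatives, recurrence\<close>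

text \<open>This is the Bessel-Clifford function with the sign of its argument reversed. It is
  entire in y, so it replaces \<open>J_1(k s) / s\<close>, with its square root s and its quotient
  at s = 0, by a smooth function of \<open>k\<^sup>2 * s\<^sup>2\<close>.\<close>

definition bessel_clifford :: "nat \<Rightarrow> real \<Rightarrow> real" where
  "bessel_clifford \<nu> y = (\<Sum>m. (-1) ^ m / (fact m * fact (m + \<nu>)) * y ^ m)"

lemma summable_bessel_clifford:
  fixes y :: real
  shows "summable (\<lambda>m. (-1) ^ m / (fact m * fact (m + \<nu>)) * y ^ m)"
proof (rule summable_comparison_test')
  show "summable (\<lambda>m. \<bar>y\<bar> ^ m / fact m)"
    using summable_exp[of "\<bar>y\<bar>"] by (simp add: divide_simps mult_ac)
  show "norm ((-1) ^ m / (fact m * fact (m + \<nu>)) * y ^ m) \<le> \<bar>y\<bar> ^ m / fact m" for m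
  proof -
    have "(fact m :: real) \<le> fact m * fact (m + \<nu>)" by simp
    then show ?thesis
      by (simp add: abs_mult power_abs divide_left_mono)
  qed
qed

lemma bessel_J_eq_clifford: "bessel_J \<nu> x = (x / 2) ^ \<nu> * bessel_clifford \<nu> (x\<^sup>2 / 4)"
proof -
  have "(x / 2) ^ \<nu> * bessel_clifford \<nu> (x\<^sup>2 / 4) =
      (\<Sum>m. (x / 2) ^ \<nu> * ((-1) ^ m / (fact m * fact (m + \<nu>)) * (x\<^sup>2 / 4) ^ m))"
    unfolding bessel_clifford_def by (rule suminf_mult[OF summable_bessel_clifford, symmetric])
  also have "\<dots> = bessel_J \<nu> x"
  proof -
    have "(x / 2) ^ (2 * m + \<nu>) = (x / 2) ^ \<nu> * (x\<^sup>2 / 4) ^ m" for m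
      by (simp only: power_add power_mult) (simp add: power_divide mult_ac)
    then show ?thesis
      unfolding bessel_J_def by (intro suminf_cong) (simp only: mult_ac)
  qed
  finally show ?thesis ..
qed

lemma bessel_clifford_0_at_0: "bessel_clifford 0 0 = 1"
  using suminf_finite[of "{0}" "\<lambda>m. (-1) ^ m / (fact m * fact m) * 0 ^ m :: real"]
  by (simp add: bessel_clifford_def)

text \<open>Termwise differentiation shifts the index by one and brings down m + 1, which cancels
  against \<open>fact (m + 1)\<close>; the remaining coefficients are those of the next order with
  the sign changed.\<close>

lemma DERIV_bessel_clifford:
  "(bessel_clifford \<nu> has_field_derivative - bessel_clifford (Suc \<nu>) y) (at y)"
proof -
  define c :: "nat \<Rightarrow> real" where "c m = (-1) ^ m / (fact m * fact (m + \<nu>))" for m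
  have "((\<lambda>y. \<Sum>m. c m * y ^ m) has_field_derivative (\<Sum>m. diffs c m * y ^ m)) (at y)"
    unfolding c_def
    by (rule termdiffs_strong_converges_everywhere) (rule summable_bessel_clifford)
  moreover have "(\<lambda>y. \<Sum>m. c m * y ^ m) = bessel_clifford \<nu>"
    by (simp add: fun_eq_iff bessel_clifford_def c_def)
  moreover have "(\<Sum>m. diffs c m * y ^ m) =
      (\<Sum>m. - ((-1) ^ m / (fact m * fact (m + Suc \<nu>)) * y ^ m))"
    by (intro suminf_cong)
       (simp add: diffs_def c_def field_simps del: of_nat_Suc)
  moreover have "\<dots> = - bessel_clifford (Suc \<nu>) y"
    unfolding bessel_clifford_def by (rule suminf_minus[OF summable_bessel_clifford])
  ultimately show ?thesis by simp
qed

text \<open>In Bessel terms this is \<open>J_0(x) + J_2(x) = 2 J_1(x) / x\<close> at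
  \<open>y = x\<^sup>2 / 4\<close>, obtained by comparing coefficients. It eliminates order 2, so
  that derivatives of orders 0 and 1 are expressed through orders 0 and 1 again.\<close>

lemma bessel_clifford_recurrence:
  "bessel_clifford 0 y = bessel_clifford 1 y - y * bessel_clifford 2 y"
proof -
  define a :: "nat \<Rightarrow> nat \<Rightarrow> real" where
    "a \<nu> m = (-1) ^ m / (fact m * fact (m + \<nu>)) * y ^ m" for \<nu> m
  have sm: "summable (a \<nu>)" for \<nu>
    unfolding a_def by (rule summable_bessel_clifford)
  have B: "bessel_clifford \<nu> y = suminf (a \<nu>)" for \<nu>
    by (simp only: bessel_clifford_def a_def[abs_def])
  have "a 0 (Suc m) = a 1 (Suc m) - y * a 2 m" for m
    unfolding a_def by (simp add: field_simps del: of_nat_Suc) (simp add: algebra_simps)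
  then have "(\<Sum>m. a 0 (Suc m)) = (\<Sum>m. a 1 (Suc m) - y * a 2 m)" by simp
  also have "\<dots> = (\<Sum>m. a 1 (Suc m)) - y * suminf (a 2)"
    using sm[of 1] sm[of 2]
    by (subst suminf_diff[symmetric]) (auto simp: suminf_mult summable_mult summable_Suc_iff)
  finally have "suminf (a 0) = suminf (a 1) - y * suminf (a 2)"
    using suminf_split_head[OF sm[of 0]] suminf_split_head[OF sm[of 1]]
    by (simp add: a_def)
  then show ?thesis by (simp add: B)
qed

lemma DERIV_bessel_clifford_0 [derivative_intros]:
  assumes "(u has_field_derivative u') (at x within A)"
  shows "((\<lambda>x. bessel_clifford 0 (u x)) has_field_derivative
      - bessel_clifford 1 (u x) * u') (at x within A)"
  using DERIV_chain2[OF DERIV_bessel_clifford[of 0 "u x"] assms] by simp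

text \<open>The Bessel identity \<open>(x J_1(x))' = x J_0(x)\<close>, stated without a division by
  q. It is used in both variables: with u depending on \<open>\<theta>\<close> and q =
  \<open>\<tau>\<^sup>2 - z\<^sup>2\<close>, and with u = \<open>\<tau>\<^sup>2 - z\<^sup>2\<close>
  and q constant.\<close>

lemma DERIV_mult_bessel_clifford_1:
  assumes "(u has_field_derivative u') (at x within A)"
  shows "((\<lambda>x. u x * bessel_clifford 1 (u x * q)) has_field_derivative
      bessel_clifford 0 (u x * q) * u') (at x within A)"
proof -
  have "((\<lambda>x. u x * q) has_field_derivative u' * q) (at x within A)"
    using assms by (rule DERIV_cmult_right)
  from DERIV_mult'[OF assms DERIV_chain2[OF DERIV_bessel_clifford[of 1] this]]
  show ?thesis
    unfolding bessel_clifford_recurrence[of "u x * q"] numeral_2_eq_2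
    by (simp add: algebra_simps)
qed

lemma continuous_on_bessel_clifford [continuous_intros]:
  assumes "continuous_on A u"
  shows "continuous_on A (\<lambda>x. bessel_clifford \<nu> (u x))"
proof -
  have "continuous_on UNIV (bessel_clifford \<nu>)"
    using DERIV_bessel_clifford by (intro DERIV_continuous_on) (auto intro: has_field_derivative_at_within)
  then show ?thesis
    using assms by (rule continuous_on_compose2) auto
qed

section \<open>Decay of J_0 and J_1 by an energy argument\<close>

text \<open>This is the energy w'(x)^2 + (1 + 1/(4 x^2)) w(x)^2 of w(x) = sqrt x * J_0(x)
  at x = 2 r, where w solves w'' + (1 + 1/(4 x^2)) w = 0.\<close>

lemma bessel_energy_antimono:
  fixes A B E :: "real \<Rightarrow> real"
  defines "A \<equiv> \<lambda>r. bessel_clifford 0 (r\<^sup>2)" and "B \<equiv> \<lambda>r. bessel_clifford 1 (r\<^sup>2)"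
  defines "E \<equiv> \<lambda>r. 2 * r ^ 3 * (B r)\<^sup>2 - r * A r * B r + (A r)\<^sup>2 / (4 * r) + 2 * r * (A r)\<^sup>2"
  assumes "0 < r" "r \<le> s"
  shows "E s \<le> E r"
proof (rule DERIV_nonpos_imp_nonincreasing[OF \<open>r \<le> s\<close>])
  fix x assume "r \<le> x" "x \<le> s"
  with \<open>0 < r\<close> have x: "x > 0" by simp
  have sq: "((\<lambda>r. r\<^sup>2) has_field_derivative 2 * x) (at x)"
    by (auto intro!: derivative_eq_intros)
  have dA: "(A has_field_derivative - 2 * x * B x) (at x)"
    using DERIV_chain2[OF DERIV_bessel_clifford[of 0] sq] by (simp add: A_def B_def mult_ac)
  have "(B has_field_derivative - bessel_clifford 2 (x\<^sup>2) * (2 * x)) (at x)"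
    using DERIV_chain2[OF DERIV_bessel_clifford[of 1] sq] by (simp add: B_def numeral_2_eq_2)
  moreover have "- bessel_clifford 2 (x\<^sup>2) * (2 * x) = (2 * A x - 2 * B x) / x"
    using x bessel_clifford_recurrence[of "x\<^sup>2"]
    by (simp add: A_def B_def field_simps power2_eq_square)
  ultimately have dB: "(B has_field_derivative (2 * A x - 2 * B x) / x) (at x)" by simp
  \<comment> \<open>By the differential equation of w only the derivative of the decreasing
    coefficient 1 + 1/(4 x^2) survives.\<close>
  have "(E has_field_derivative - (A x)\<^sup>2 / (4 * x\<^sup>2)) (at x)"
    unfolding E_def using x
    by (auto intro!: derivative_eq_intros dA dB simp del: power_Suc)
       (simp add: field_simps power2_eq_square power3_eq_cube)
  moreover have "- (A x)\<^sup>2 / (4 * x\<^sup>2) \<le> 0" using x by simp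
  ultimately show "\<exists>y. (E has_real_derivative y) (at x) \<and> y \<le> 0" by blast
qed

text \<open>With x = 2 r the bounds say that x J_0(x)^2 and x J_1(x)^2 stay bounded. For r \<ge> 1
  the energy dominates both quantities and is at most its value at 1; on (0, 1] continuity on a
  compact interval suffices.\<close>

lemma bessel_clifford_decay:
  obtains K where "K \<ge> 0"
    "\<And>r. r > 0 \<Longrightarrow> r * (bessel_clifford 0 (r\<^sup>2))\<^sup>2 \<le> K"
    "\<And>r. r > 0 \<Longrightarrow> r ^ 3 * (bessel_clifford 1 (r\<^sup>2))\<^sup>2 \<le> K"
proof -
  define A where "A r = bessel_clifford 0 (r\<^sup>2)" for r
  define B where "B r = bessel_clifford 1 (r\<^sup>2)" for r
  define E where "E r = 2 * r ^ 3 * (B r)\<^sup>2 - r * A r * B r + (A r)\<^sup>2 / (4 * r) + 2 * r * (A r)\<^sup>2" for r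
  have ge1: "r ^ 3 * (B r)\<^sup>2 + r * (A r)\<^sup>2 \<le> E 1" if "r \<ge> 1" for r
  proof -
    have "E r \<le> E 1"
      using bessel_energy_antimono[of 1 r] that by (simp add: E_def A_def B_def)
    \<comment> \<open>Completing the square absorbs the mixed term of \<open>E r\<close> and costs
      only one of the two copies of \<open>r ^ 3 * (B r)\<^sup>2\<close>.\<close>
    moreover have "0 \<le> (2 * r\<^sup>2 * B r - A r)\<^sup>2 / (4 * r)" using that by simp
    moreover have "(2 * r\<^sup>2 * B r - A r)\<^sup>2 / (4 * r) = r ^ 3 * (B r)\<^sup>2 - r * A r * B r + (A r)\<^sup>2 / (4 * r)"
      using that by (simp add: field_simps power2_eq_square power3_eq_cube)
    moreover have "0 \<le> r * (A r)\<^sup>2" using that by simp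
    ultimately show ?thesis unfolding E_def[of r] by linarith
  qed
  have "continuous_on {0..1} (\<lambda>r. r ^ 3 * (B r)\<^sup>2 + r * (A r)\<^sup>2)"
    unfolding A_def B_def by (intro continuous_intros)
  then obtain x0 where x0: "\<And>r. r \<in> {0..1} \<Longrightarrow>
      r ^ 3 * (B r)\<^sup>2 + r * (A r)\<^sup>2 \<le> x0 ^ 3 * (B x0)\<^sup>2 + x0 * (A x0)\<^sup>2"
    using continuous_attains_sup[of "{0..1::real}" "\<lambda>r. r ^ 3 * (B r)\<^sup>2 + r * (A r)\<^sup>2"]
    by (auto simp del: atLeastAtMost_iff)
  define K where "K = max (E 1) (x0 ^ 3 * (B x0)\<^sup>2 + x0 * (A x0)\<^sup>2)"
  have K: "r ^ 3 * (B r)\<^sup>2 + r * (A r)\<^sup>2 \<le> K" if "r > 0" for r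
    using ge1[of r] x0[of r] that unfolding K_def by (cases "r \<ge> 1") auto
  show ?thesis
  proof (rule that[of K])
    show "K \<ge> 0" using K[of 1] by (simp, metis add_nonneg_nonneg order_trans zero_le_power2)
    fix r :: real assume r: "r > 0"
    then have "0 \<le> r ^ 3 * (B r)\<^sup>2" "0 \<le> r * (A r)\<^sup>2" by simp_all
    with K[OF r] show "r * (bessel_clifford 0 (r\<^sup>2))\<^sup>2 \<le> K" "r ^ 3 * (bessel_clifford 1 (r\<^sup>2))\<^sup>2 \<le> K"
      by (simp_all add: A_def B_def)
  qed
qed

text \<open>This supplies the constant majorant for dominated convergence. The decay bound says
  nothing near 0, so continuity covers [0, 1]; beyond 1 the factor \<open>sqrt y\<close> is at least
  1 and may be dropped.\<close>

lemma bessel_clifford_0_bounded: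
  obtains M where "\<And>y. y \<ge> 0 \<Longrightarrow> \<bar>bessel_clifford 0 y\<bar> \<le> M"
proof -
  obtain K where K: "K \<ge> 0" "\<And>r. r > 0 \<Longrightarrow> r * (bessel_clifford 0 (r\<^sup>2))\<^sup>2 \<le> K"
    by (rule bessel_clifford_decay) blast
  have "continuous_on {0..1} (\<lambda>y. bessel_clifford 0 y)"
    by (intro continuous_intros)
  then have "bounded (bessel_clifford 0 ` {0..1})"
    using compact_imp_bounded compact_continuous_image by blast
  then obtain M where M: "\<And>y. y \<in> {0..1} \<Longrightarrow> \<bar>bessel_clifford 0 y\<bar> \<le> M"
    unfolding bounded_iff by force
  show thesis
  proof (rule that[of "max M (sqrt K)"])
    fix y :: real assume "y \<ge> 0"
    show "\<bar>bessel_clifford 0 y\<bar> \<le> max M (sqrt K)"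
    proof (cases "y \<le> 1")
      case True
      then show ?thesis using M[of y] \<open>y \<ge> 0\<close> by auto
    next
      case False
      then have "sqrt y > 0" "sqrt y \<ge> 1" by auto
      have "(bessel_clifford 0 y)\<^sup>2 \<le> sqrt y * (bessel_clifford 0 y)\<^sup>2"
        using \<open>sqrt y \<ge> 1\<close> by (simp add: mult_le_cancel_right1)
      also have "\<dots> \<le> K" using K(2)[of "sqrt y"] False by simp
      finally have "\<bar>bessel_clifford 0 y\<bar> \<le> sqrt K" by (simp add: real_le_rsqrt)
      then show ?thesis by simp
    qed
  qed
qed

lemma tendsto_bessel_clifford_0: "(bessel_clifford 0 \<longlongrightarrow> 0) at_top"
proof -
  obtain K where K: "K \<ge> 0" "\<And>r. r > 0 \<Longrightarrow> r * (bessel_clifford 0 (r\<^sup>2))\<^sup>2 \<le> K"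
    by (rule bessel_clifford_decay) blast
  have "((\<lambda>y. (bessel_clifford 0 y)\<^sup>2) \<longlongrightarrow> 0) at_top"
  proof (rule tendsto_sandwich[of "\<lambda>_. 0" _ _ "\<lambda>y. K / sqrt y"])
    show "\<forall>\<^sub>F y in at_top. (bessel_clifford 0 y)\<^sup>2 \<le> K / sqrt y"
      using eventually_gt_at_top[of 0]
    proof eventually_elim
      case (elim y)
      then show ?case using K(2)[of "sqrt y"] by (simp add: field_simps)
    qed
    show "((\<lambda>y. K / sqrt y) \<longlongrightarrow> 0) at_top"
      by (intro tendsto_divide_0[OF tendsto_const] filterlim_at_top_imp_at_infinity sqrt_at_top)
  qed auto
  then show ?thesis by (simp add: tendsto_power_zero power_tendsto_0_iff)
qed

section \<open>The truncated transfer function along the curve p^2 + k^2 = P\<close>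

text \<open>Here p = v \<theta> with \<sigma> = v^2 real, so that k^2 = P - \<sigma> \<theta>^2 on the curve p^2 + k^2 = P. In terms of
  Bessel-Clifford functions the integrand depends on k^2 only, hence smoothly on \<theta> even where k = 0.\<close>

definition mode_transfer :: "complex \<Rightarrow> real \<Rightarrow> real \<Rightarrow> real \<Rightarrow> real \<Rightarrow> real \<Rightarrow> complex" where
  "mode_transfer v \<sigma> P z T \<theta> =
    exp (- (v * of_real (\<theta> * z))) - 2 * of_real z *
      integral {z..T} (\<lambda>\<tau>. of_real ((P - \<sigma> * \<theta>\<^sup>2) / 4 * bessel_clifford 1 ((P - \<sigma> * \<theta>\<^sup>2) / 4 * (\<tau>\<^sup>2 - z\<^sup>2)))
        * exp (- (v * of_real (\<theta> * \<tau>))))"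

lemma has_vector_derivative_exp_mult:
  fixes v :: complex
  shows "((\<lambda>x. exp (- (v * of_real (x * y)))) has_vector_derivative
     - (v * of_real y) * exp (- (v * of_real (x * y)))) (at x within A)"
proof -
  have "((\<lambda>w. exp (- (v * (w * of_real y)))) has_field_derivative
     - (v * of_real y) * exp (- (v * of_real (x * y)))) (at (of_real x))"
    by (auto intro!: derivative_eq_intros)
  from has_vector_derivative_real_field[OF this] show ?thesis by simp
qed

text \<open>Differentiation under the integral gives an integrand that is, up to a factor, an exact
  derivative in \<open>\<tau>\<close>. Its boundary term at \<open>\<tau> = z\<close>, where the
  Bessel factor is 1, cancels the derivative of the leading exponential, and only the boundary term
  at T is left.\<close>

lemma mode_transfer_derivative:
  assumes v: "v\<^sup>2 = of_real \<sigma>" and T: "z \<le> T" and \<theta>: "\<theta> \<in> {\<alpha>..\<beta>}"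
  shows "(mode_transfer v \<sigma> P z T has_vector_derivative
     - (of_real z * v * of_real (bessel_clifford 0 ((P - \<sigma> * \<theta>\<^sup>2) / 4 * (T\<^sup>2 - z\<^sup>2))) *
        exp (- (v * of_real (\<theta> * T))))) (at \<theta> within {\<alpha>..\<beta>})"
proof -
  define c where "c = (\<lambda>\<theta>. (P - \<sigma> * \<theta>\<^sup>2) / 4)"
  define a where "a = (\<lambda>\<theta> \<tau>. bessel_clifford 0 (c \<theta> * (\<tau>\<^sup>2 - z\<^sup>2)))"
  define b where "b = (\<lambda>\<theta> \<tau>. bessel_clifford 1 (c \<theta> * (\<tau>\<^sup>2 - z\<^sup>2)))"
  define e where "e = (\<lambda>\<theta> \<tau>. exp (- (v * of_real (\<theta> * \<tau>))))"
  define F where "F = (\<lambda>\<theta> \<tau>. of_real (c \<theta> * b \<theta> \<tau>) * e \<theta> \<tau>)"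
  define F' where "F' = (\<lambda>\<theta> \<tau>. of_real (c \<theta> * b \<theta> \<tau>) * (- (v * of_real \<tau>) * e \<theta> \<tau>) +
    of_real (a \<theta> \<tau> * (- \<sigma> * \<theta> / 2)) * e \<theta> \<tau>)"
  have dc: "(c has_field_derivative - \<sigma> * \<theta> / 2) (at \<theta> within S)" for \<theta> S
    unfolding c_def by (auto intro!: derivative_eq_intros)
  have cont_c: "continuous_on S (\<lambda>x. c (f x))"
    if "continuous_on S f" for f :: "'c :: topological_space \<Rightarrow> real" and S
    unfolding c_def using that by (auto intro!: continuous_intros)
  have cont: "continuous_on S (\<lambda>x. a (f x) (g x))"
    "continuous_on S (\<lambda>x. b (f x) (g x))" "continuous_on S (\<lambda>x. e (f x) (g x))"
    if "continuous_on S f" "continuous_on S g" for f g :: "'c :: topological_space \<Rightarrow> real" and S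
    unfolding a_def b_def c_def e_def using that by (auto intro!: continuous_intros)
  have dF: "((\<lambda>\<theta>. F \<theta> \<tau>) has_vector_derivative F' \<theta> \<tau>) (at \<theta> within {\<alpha>..\<beta>})" for \<theta> \<tau>
  proof -
    have "((\<lambda>\<theta>. c \<theta> * b \<theta> \<tau>) has_field_derivative a \<theta> \<tau> * (- \<sigma> * \<theta> / 2)) (at \<theta> within {\<alpha>..\<beta>})"
      unfolding a_def b_def
      by (rule DERIV_mult_bessel_clifford_1[OF dc])
    from has_vector_derivative_mult[OF has_vector_derivative_of_real[OF this]
        has_vector_derivative_exp_mult[of v \<tau> \<theta>]]
    show ?thesis unfolding F_def F'_def e_def by simp
  qed
  have dI: "((\<lambda>\<theta>. integral (cbox z T) (F \<theta>)) has_vector_derivative integral (cbox z T) (F' \<theta>))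
      (at \<theta> within {\<alpha>..\<beta>})"
  proof (rule leibniz_rule_vector_derivative[OF dF _ _ \<theta>])
    show "F \<theta> integrable_on cbox z T" for \<theta>
      unfolding F_def by (intro integrable_continuous continuous_intros cont_c cont)
    show "continuous_on ({\<alpha>..\<beta>} \<times> cbox z T) (\<lambda>(\<theta>, \<tau>). F' \<theta> \<tau>)"
      unfolding F'_def split_def by (intro continuous_intros cont_c cont) auto
  qed auto
  have I: "2 * of_real z * integral (cbox z T) (F' \<theta>) =
      of_real z * v * (of_real (a \<theta> T) * e \<theta> T - e \<theta> z)"
  proof -
    \<comment> \<open>\<open>W\<close> is the antiderivative in \<open>\<tau>\<close>: since
      \<open>v\<^sup>2 = \<sigma>\<close>, multiplying \<open>W'\<close> by v yields
      \<open>2 * F' \<theta> \<tau>\<close>.\<close>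
    define W where "W = (\<lambda>\<tau>. of_real (a \<theta> \<tau>) * e \<theta> \<tau>)"
    define W' where "W' = (\<lambda>\<tau>. of_real (a \<theta> \<tau>) * (- (v * of_real \<theta>) * e \<theta> \<tau>) +
        of_real (- b \<theta> \<tau> * (c \<theta> * (2 * \<tau>))) * e \<theta> \<tau>)"
    have "(W has_vector_derivative W' \<tau>) (at \<tau> within {z..T})" for \<tau>
    proof -
      have "(a \<theta> has_field_derivative - b \<theta> \<tau> * (c \<theta> * (2 * \<tau>))) (at \<tau> within {z..T})"
        unfolding a_def b_def
        by (auto intro!: derivative_eq_intros)
      from has_vector_derivative_mult[OF has_vector_derivative_of_real[OF this]
          has_vector_derivative_exp_mult[of v \<theta> \<tau>]]
      show ?thesis unfolding W_def W'_def e_def by (simp add: mult.commute[of _ \<theta>])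
    qed
    then have "(W' has_integral W T - W z) (cbox z T)"
      using fundamental_theorem_of_calculus[of z T W W'] T by simp
    then have "((\<lambda>\<tau>. of_real z * v * W' \<tau>) has_integral of_real z * v * (W T - W z)) (cbox z T)"
      by (rule has_integral_mult_right)
    moreover have "of_real z * v * W' \<tau> = 2 * of_real z * F' \<theta> \<tau>" for \<tau>
    proof -
      have "v * v = of_real \<sigma>" using v by (simp add: power2_eq_square)
      then have "v * W' \<tau> = 2 * F' \<theta> \<tau>"
        unfolding W'_def F'_def by (simp add: algebra_simps)
      then show ?thesis by simp
    qed
    ultimately have F'_int: "((\<lambda>\<tau>. 2 * of_real z * F' \<theta> \<tau>) has_integral of_real z * v * (W T - W z)) (cbox z T)"
      by simp
    have "2 * of_real z * integral (cbox z T) (F' \<theta>) = integral (cbox z T) (\<lambda>\<tau>. 2 * of_real z * F' \<theta> \<tau>)"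
      by (rule integral_mult_right[symmetric])
    also have "\<dots> = of_real z * v * (W T - W z)"
      using F'_int by (rule integral_unique)
    also have "W z = e \<theta> z"
      by (simp add: W_def a_def bessel_clifford_0_at_0)
    finally show ?thesis by (simp only: W_def)
  qed
  have "((\<lambda>\<theta>. e \<theta> z - 2 * of_real z * integral (cbox z T) (F \<theta>)) has_vector_derivative
     - (v * of_real z) * e \<theta> z - of_real z * v * (of_real (a \<theta> T) * e \<theta> T - e \<theta> z)) (at \<theta> within {\<alpha>..\<beta>})"
    unfolding e_def I[unfolded e_def, symmetric]
    by (rule has_vector_derivative_diff[OF has_vector_derivative_exp_mult
          has_vector_derivative_mult_right[OF dI]])
  moreover have "(\<lambda>\<theta>. e \<theta> z - 2 * of_real z * integral (cbox z T) (F \<theta>)) = mode_transfer v \<sigma> P z T"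
    by (simp add: mode_transfer_def e_def F_def b_def c_def fun_eq_iff)
  moreover have "- (v * of_real z) * e \<theta> z - of_real z * v * (of_real (a \<theta> T) * e \<theta> T - e \<theta> z) =
      - (of_real z * v * of_real (a \<theta> T) * e \<theta> T)"
    by (simp add: algebra_simps)
  ultimately show ?thesis
    by (simp only: a_def c_def e_def)
qed

text \<open>The difference is the integral of the \<open>\<theta>\<close>-derivative. As
  \<open>Re v \<ge> 0\<close>, the exponential has modulus at most 1, so what remains is an integral
  of |J_0| with argument tending to infinity wherever k^2 > 0. Positivity is asked on the open
  interval because a path may end at a point where k = 0.\<close>

lemma mode_transfer_shift:
  assumes v: "v\<^sup>2 = of_real \<sigma>" "Re v \<ge> 0" and "z > 0" and "0 \<le> \<alpha>" "\<alpha> \<le> \<beta>"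
    and pos: "\<And>\<theta>. \<theta> \<in> {\<alpha><..<\<beta>} \<Longrightarrow> P - \<sigma> * \<theta>\<^sup>2 > 0"
  shows "((\<lambda>T. mode_transfer v \<sigma> P z T \<beta> - mode_transfer v \<sigma> P z T \<alpha>) \<longlongrightarrow> 0) at_top"
proof -
  define c where "c = (\<lambda>\<theta>. (P - \<sigma> * \<theta>\<^sup>2) / 4)"
  define h where "h = (\<lambda>T \<theta>. \<bar>bessel_clifford 0 (c \<theta> * (T\<^sup>2 - z\<^sup>2))\<bar>)"
  have cont: "continuous_on S (h T)" for T S
    unfolding h_def c_def by (intro continuous_intros) auto
  have "((\<lambda>T. integral {\<alpha>..\<beta>} (h T)) \<longlongrightarrow> 0) at_top"
  proof (rule tendsto_at_topI_sequentially)
    fix X :: "nat \<Rightarrow> real" assume X: "filterlim X at_top sequentially"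
    obtain M where M: "\<And>y. y \<ge> 0 \<Longrightarrow> \<bar>bessel_clifford 0 y\<bar> \<le> M"
      using bessel_clifford_0_bounded by blast
    \<comment> \<open>Discarding the first N members of the sequence gives T \<ge> z, hence
      nonnegative Bessel arguments, for which the majorant M is valid.\<close>
    obtain N where N: "\<And>n. n \<ge> N \<Longrightarrow> X n \<ge> z"
      using X unfolding filterlim_at_top eventually_sequentially by blast
    have "(\<lambda>n. integral {\<alpha><..<\<beta>} (h (X (n + N)))) \<longlonglongrightarrow> integral {\<alpha><..<\<beta>} (\<lambda>_. 0)"
    proof (rule dominated_convergence(2)[where h = "\<lambda>_. M"])
      show "h (X (n + N)) integrable_on {\<alpha><..<\<beta>}" for n
        using integrable_continuous_interval[OF cont]
        by (simp add: integrable_on_open_interval_real)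
      show "(\<lambda>_. M) integrable_on {\<alpha><..<\<beta>}"
        by (simp add: integrable_on_open_interval_real integrable_continuous_interval)
      fix \<theta> assume \<theta>: "\<theta> \<in> {\<alpha><..<\<beta>}"
      then have c: "c \<theta> > 0" using pos by (simp add: c_def)
      show "norm (h (X (n + N)) \<theta>) \<le> M" for n
      proof -
        have "(X (n + N))\<^sup>2 \<ge> z\<^sup>2" using N[of "n + N"] \<open>z > 0\<close> by (intro power_mono) auto
        then show ?thesis using c M by (simp add: h_def)
      qed
      have "filterlim (\<lambda>n. X (n + N)) at_top sequentially"
        using filterlim_compose[OF X filterlim_add_const_nat_at_top] .
      then have "filterlim (\<lambda>n. c \<theta> * (- z\<^sup>2 + (X (n + N))\<^sup>2)) at_top sequentially"
        by (intro filterlim_tendsto_pos_mult_at_top[OF tendsto_const c]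
            filterlim_tendsto_add_at_top[OF tendsto_const] filterlim_pow_at_top) auto
      from filterlim_compose[OF tendsto_bessel_clifford_0 this]
      show "(\<lambda>n. h (X (n + N)) \<theta>) \<longlonglongrightarrow> 0"
        unfolding h_def by (intro tendsto_rabs_zero) (simp add: algebra_simps)
    qed
    then have "(\<lambda>n. integral {\<alpha>..\<beta>} (h (X (n + N)))) \<longlonglongrightarrow> 0"
      by (simp add: integral_open_interval_real)
    then show "(\<lambda>n. integral {\<alpha>..\<beta>} (h (X n))) \<longlonglongrightarrow> 0"
      using LIMSEQ_offset[of "\<lambda>n. integral {\<alpha>..\<beta>} (h (X n))" N] by simp
  qed
  then have "((\<lambda>T. z * norm v * integral {\<alpha>..\<beta>} (h T)) \<longlongrightarrow> 0) at_top"
    by (rule tendsto_mult_right_zero)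
  moreover have "\<forall>\<^sub>F T in at_top. norm (mode_transfer v \<sigma> P z T \<beta> - mode_transfer v \<sigma> P z T \<alpha>)
      \<le> z * norm v * integral {\<alpha>..\<beta>} (h T)"
    using eventually_ge_at_top[of z]
  proof eventually_elim
    case (elim T)
    define G' where "G' = (\<lambda>\<theta>. - (of_real z * v * of_real (bessel_clifford 0 (c \<theta> * (T\<^sup>2 - z\<^sup>2))) *
        exp (- (v * of_real (\<theta> * T)))))"
    have I: "(G' has_integral mode_transfer v \<sigma> P z T \<beta> - mode_transfer v \<sigma> P z T \<alpha>) {\<alpha>..\<beta>}"
      unfolding G'_def c_def
      by (intro fundamental_theorem_of_calculus \<open>\<alpha> \<le> \<beta>\<close> mode_transfer_derivative[OF v(1) elim])
    have "norm (integral {\<alpha>..\<beta>} G') \<le> integral {\<alpha>..\<beta>} (\<lambda>\<theta>. z * norm v * h T \<theta>)"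
    proof (rule integral_norm_bound_integral)
      show "G' integrable_on {\<alpha>..\<beta>}" using I by blast
      show "(\<lambda>\<theta>. z * norm v * h T \<theta>) integrable_on {\<alpha>..\<beta>}"
        by (intro integrable_continuous_interval continuous_intros cont)
      fix \<theta> assume "\<theta> \<in> {\<alpha>..\<beta>}"
      then have "exp (- (Re v * (\<theta> * T))) \<le> 1"
        using v(2) \<open>0 \<le> \<alpha>\<close> \<open>z > 0\<close> elim by simp
      then show "norm (G' \<theta>) \<le> z * norm v * h T \<theta>"
        using \<open>z > 0\<close> by (simp add: G'_def h_def norm_mult mult_left_le)
    qed
    then show ?case using integral_unique[OF I] by simp
  qed
  ultimately show ?thesis by (rule Lim_null_comparison[rotated])
qed

section \<open>The modes of u and the limit of their transfer functions\<close>

text \<open>This is the bracket in \<open>wave_term\<close> with \<open>J_1(k s) / s\<close>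
  replaced by k/2 times a Bessel-Clifford value; the prefactor \<open>k z * k/2\<close> is written
  as \<open>2 z * k\<^sup>2/4\<close>. The integrand becomes continuous up to
  \<open>\<tau> = z\<close>, and k enters only through its square.\<close>

definition mode_response :: "real \<Rightarrow> real \<Rightarrow> real \<Rightarrow> real \<Rightarrow> real" where
  "mode_response \<omega> k z t = sin (\<omega> * (t - z)) -
    2 * z * integral {z..t} (\<lambda>\<tau>. k\<^sup>2 / 4 * bessel_clifford 1 (k\<^sup>2 / 4 * (\<tau>\<^sup>2 - z\<^sup>2)) * sin (\<omega> * (t - \<tau>)))"

lemma wave_term_eq_mode_response:
  assumes "z > 0" "t \<ge> z"
  shows "wave_term d \<omega> g t x z n =
    cos_coeff d g n * cos (wavenumber d n * x) * mode_response \<omega> (wavenumber d n) z t"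
proof -
  define k where "k = wavenumber d n"
  define F where "F = (\<lambda>\<tau>. bessel_clifford 1 (k\<^sup>2 / 4 * (\<tau>\<^sup>2 - z\<^sup>2)) * sin (\<omega> * (t - \<tau>)))"
  have "integral {z..t} (\<lambda>\<tau>. bessel_J 1 (k * sqrt (\<tau>\<^sup>2 - z\<^sup>2)) / sqrt (\<tau>\<^sup>2 - z\<^sup>2) * sin (\<omega> * (t - \<tau>)))
    = integral {z..t} (\<lambda>\<tau>. k / 2 * F \<tau>)"
  \<comment> \<open>At \<open>\<tau> = z\<close> the quotient on the left is 0 / 0 = 0, which need
    not agree with the right side; the single point is a null set.\<close>
  proof (rule integral_spike[of "{z}"])
    fix \<tau> assume "\<tau> \<in> {z..t} - {z}"
    then have "\<tau>\<^sup>2 - z\<^sup>2 > 0" using \<open>z > 0\<close> by (simp add: power_strict_mono)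
    then show "k / 2 * F \<tau> =
        bessel_J 1 (k * sqrt (\<tau>\<^sup>2 - z\<^sup>2)) / sqrt (\<tau>\<^sup>2 - z\<^sup>2) * sin (\<omega> * (t - \<tau>))"
      by (simp add: F_def bessel_J_eq_clifford power_mult_distrib)
  qed auto
  then have e1: "k * z * integral {z..t} (\<lambda>\<tau>. bessel_J 1 (k * sqrt (\<tau>\<^sup>2 - z\<^sup>2)) / sqrt (\<tau>\<^sup>2 - z\<^sup>2) * sin (\<omega> * (t - \<tau>)))
    = k * z * (k / 2 * integral {z..t} F)"
    by (simp only: integral_mult_right)
  have e2: "integral {z..t} (\<lambda>\<tau>. k\<^sup>2 / 4 * bessel_clifford 1 (k\<^sup>2 / 4 * (\<tau>\<^sup>2 - z\<^sup>2)) * sin (\<omega> * (t - \<tau>)))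
    = k\<^sup>2 / 4 * integral {z..t} F"
    unfolding F_def mult.assoc[of "k\<^sup>2 / 4" "bessel_clifford 1 _"] by (rule integral_mult_right)
  have e3: "2 * z * (k\<^sup>2 / 4 * I) = k * z * (k / 2 * I)" for I
    by (simp add: power2_eq_square)
  have e4: "heaviside (t - z) = 1"
    using assms by (simp add: heaviside_def)
  show ?thesis
    unfolding wave_term_def mode_response_def k_def[symmetric] e1 e2 e3 e4 by (simp only: mult_1_right mult_ac)
qed

text \<open>The parameters are chosen so that \<open>P - \<sigma> * \<theta>\<^sup>2\<close> equals
  \<open>k\<^sup>2\<close> at \<open>\<theta> = \<omega>\<close>. The Bessel factor is real, so
  taking imaginary parts turns each product of exponentials into
  \<open>sin (\<omega> * (t - \<tau>))\<close>.\<close>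

lemma mode_response_eq_transfer:
  "mode_response \<omega> k z t =
    Im (exp (\<i> * of_real (\<omega> * t)) * mode_transfer \<i> (- 1) (k\<^sup>2 - \<omega>\<^sup>2) z t \<omega>)"
proof -
  define b where "b = (\<lambda>\<tau>. k\<^sup>2 / 4 * bessel_clifford 1 (k\<^sup>2 / 4 * (\<tau>\<^sup>2 - z\<^sup>2)))"
  define F where "F = (\<lambda>\<tau>. of_real (b \<tau>) * exp (- (\<i> * of_real (\<omega> * \<tau>))))"
  define E where "E = exp (\<i> * of_real (\<omega> * t))"
  have E: "E * exp (- (\<i> * of_real (\<omega> * \<tau>))) = cis (\<omega> * (t - \<tau>))" for \<tau>
    unfolding E_def cis_conv_exp exp_add[symmetric] by (simp add: algebra_simps)
  have "F integrable_on {z..t}"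
    unfolding F_def b_def by (intro integrable_continuous_interval continuous_intros)
  then have "(F has_integral integral {z..t} F) {z..t}" by (rule integrable_integral)
  then have "((\<lambda>\<tau>. E * F \<tau>) has_integral E * integral {z..t} F) {z..t}"
    by (rule has_integral_mult_right)
  from has_integral_linear[OF this bounded_linear_Im]
  have "((\<lambda>\<tau>. Im (E * F \<tau>)) has_integral Im (E * integral {z..t} F)) {z..t}"
    by (simp add: o_def)
  moreover have "Im (E * F \<tau>) = b \<tau> * sin (\<omega> * (t - \<tau>))" for \<tau>
  proof -
    have "E * F \<tau> = of_real (b \<tau>) * cis (\<omega> * (t - \<tau>))"
      by (simp add: F_def E[symmetric])
    then show ?thesis by simp
  qed
  ultimately have "Im (E * integral {z..t} F) = integral {z..t} (\<lambda>\<tau>. b \<tau> * sin (\<omega> * (t - \<tau>)))"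
    by (simp add: integral_unique)
  moreover have "mode_transfer \<i> (- 1) (k\<^sup>2 - \<omega>\<^sup>2) z t \<omega> =
      exp (- (\<i> * of_real (\<omega> * z))) - 2 * of_real z * integral {z..t} F"
    by (simp add: mode_transfer_def F_def b_def)
  then have "E * mode_transfer \<i> (- 1) (k\<^sup>2 - \<omega>\<^sup>2) z t \<omega> =
      cis (\<omega> * (t - z)) - of_real (2 * z) * (E * integral {z..t} F)"
    using E[of z] by (simp add: right_diff_distrib)
  then have "Im (E * mode_transfer \<i> (- 1) (k\<^sup>2 - \<omega>\<^sup>2) z t \<omega>) =
      sin (\<omega> * (t - z)) - 2 * z * Im (E * integral {z..t} F)"
    by simp
  ultimately show ?thesis by (simp add: mode_response_def b_def E_def)
qed

lemma mode_transfer_tendsto: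
  assumes "\<omega> > 0" "z > 0"
  shows "((\<lambda>T. mode_transfer \<i> (- 1) (k\<^sup>2 - \<omega>\<^sup>2) z T \<omega>) \<longlongrightarrow> helmholtz_factor \<omega> k z) at_top"
proof (cases "\<bar>k\<bar> \<le> \<omega>")
    case True
    \<comment> \<open>The path runs down the imaginary half-axis to the point where
      \<open>P - \<sigma> * \<theta>\<^sup>2\<close> is 0; there the integral drops out and the
      exponential is already the Helmholtz factor.\<close>
    define \<alpha> where "\<alpha> = sqrt (\<omega>\<^sup>2 - k\<^sup>2)"
    have "k\<^sup>2 \<le> \<omega>\<^sup>2" using True by (simp add: abs_le_square_iff[symmetric])
    then have \<alpha>: "\<alpha> \<ge> 0" "\<alpha>\<^sup>2 = \<omega>\<^sup>2 - k\<^sup>2" by (simp_all add: \<alpha>_def)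
    have "\<alpha> \<le> \<omega>" using \<open>\<omega> > 0\<close> by (simp add: \<alpha>_def real_le_lsqrt)
    have "((\<lambda>T. mode_transfer \<i> (- 1) (k\<^sup>2 - \<omega>\<^sup>2) z T \<omega> - mode_transfer \<i> (- 1) (k\<^sup>2 - \<omega>\<^sup>2) z T \<alpha>) \<longlongrightarrow> 0) at_top"
    proof (rule mode_transfer_shift)
      fix \<theta> assume "\<theta> \<in> {\<alpha><..<\<omega>}"
      then have "\<alpha>\<^sup>2 < \<theta>\<^sup>2" using \<alpha>(1) by (intro power_strict_mono) auto
      then show "0 < k\<^sup>2 - \<omega>\<^sup>2 - - 1 * \<theta>\<^sup>2" using \<alpha>(2) by simp
    qed (use \<alpha> \<open>\<alpha> \<le> \<omega>\<close> assms in auto)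
    moreover have "mode_transfer \<i> (- 1) (k\<^sup>2 - \<omega>\<^sup>2) z T \<alpha> = helmholtz_factor \<omega> k z" for T
      using True by (simp add: mode_transfer_def helmholtz_factor_def \<alpha>(2) \<alpha>_def[symmetric] mult_ac)
    ultimately show ?thesis
      by (simp add: LIM_zero_iff)
  next
    case False
    define P where "P = k\<^sup>2 - \<omega>\<^sup>2"
    have "P > 0" using False \<open>\<omega> > 0\<close> power_strict_mono[of \<omega> "\<bar>k\<bar>" 2] by (simp add: P_def)
    define \<beta> where "\<beta> = sqrt P"
    have \<beta>: "\<beta> \<ge> 0" "\<beta>\<^sup>2 = P" using \<open>P > 0\<close> by (simp_all add: \<beta>_def)
    \<comment> \<open>Here k^2 stays positive on the whole imaginary leg, so the path goes on from 0
      along the real half-axis up to \<open>\<beta>\<close>. The two legs are joined at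
      \<open>\<theta> = 0\<close>, where \<open>mode_transfer\<close> does not depend on v and
      \<open>\<sigma>\<close>.\<close>
    have "((\<lambda>T. mode_transfer \<i> (- 1) P z T \<omega> - mode_transfer \<i> (- 1) P z T 0) \<longlongrightarrow> 0) at_top"
      by (rule mode_transfer_shift) (use \<open>P > 0\<close> assms in \<open>auto intro: add_pos_nonneg\<close>)
    moreover have "((\<lambda>T. mode_transfer 1 1 P z T \<beta> - mode_transfer 1 1 P z T 0) \<longlongrightarrow> 0) at_top"
    proof (rule mode_transfer_shift)
      fix \<theta> assume "\<theta> \<in> {0<..<\<beta>}"
      then have "\<theta>\<^sup>2 < \<beta>\<^sup>2" by (intro power_strict_mono) auto
      then show "0 < P - 1 * \<theta>\<^sup>2" using \<beta>(2) by simp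
    qed (use \<beta> assms in auto)
    ultimately have "((\<lambda>T. (mode_transfer \<i> (- 1) P z T \<omega> - mode_transfer \<i> (- 1) P z T 0)
        - (mode_transfer 1 1 P z T \<beta> - mode_transfer 1 1 P z T 0)) \<longlongrightarrow> 0 - 0) at_top"
      by (rule tendsto_diff)
    moreover have "mode_transfer \<i> (- 1) P z T 0 = mode_transfer 1 1 P z T 0" for T
      by (simp add: mode_transfer_def)
    moreover have "mode_transfer 1 1 P z T \<beta> = helmholtz_factor \<omega> k z" for T
    proof -
      have "mode_transfer 1 1 P z T \<beta> = exp (- of_real (\<beta> * z))"
        by (simp add: mode_transfer_def \<beta>(2))
      also have "\<dots> = of_real (exp (- z * \<beta>))"
        by (simp add: exp_of_real[symmetric] mult_ac)
      finally show ?thesis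
        using False by (simp add: helmholtz_factor_def \<beta>_def P_def)
    qed
    ultimately show ?thesis
      by (simp add: LIM_zero_iff P_def)
qed

section \<open>Decay of the modes in k, uniformly in t\<close>

text \<open>The integral is integrated by parts twice, first with the derivative of J_0 and then
  with that of \<open>B\<close>, a multiple of s J_1(k s) / k. The first boundary term at z cancels
  the free sine. The decay of J_1 bounds \<open>B\<close> by \<open>sqrt \<tau>\<close> times
  |k|^(-3/2), and the remaining factor is of order \<open>\<tau>\<close> to the power -2, so the
  integral is bounded uniformly in t.\<close>

lemma mode_response_bound:
  assumes "\<omega> > 0" "z > 0"
  obtains C where "C \<ge> 0"
    "\<And>k t. k \<noteq> 0 \<Longrightarrow> t \<ge> z \<Longrightarrow> \<bar>mode_response \<omega> k z t\<bar> \<le> C * \<bar>k\<bar> powr (- 3 / 2)"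
proof -
  obtain K where K: "K \<ge> 0" "\<And>r. r > 0 \<Longrightarrow> r ^ 3 * (bessel_clifford 1 (r\<^sup>2))\<^sup>2 \<le> K"
    by (rule bessel_clifford_decay) blast
  \<comment> \<open>\<open>L\<close> and \<open>L'\<close> bound
    \<open>\<tau>\<^sup>2 * h \<tau>\<close> and \<open>\<tau>\<^sup>2 * h' \<tau>\<close> for
    \<open>\<tau> \<ge> z\<close>. In \<open>C\<close>, \<open>L\<close> belongs to the boundary
    term at t, and \<open>2 / sqrt z\<close> is the integral of \<open>\<tau>\<close> to the power
    -3/2 over [z, \<infinity>).\<close>
  define L where "L = \<omega> / 2 + 1 / (2 * z)"
  define L' where "L' = \<omega>\<^sup>2 / 2 + 3 * \<omega> / (2 * z) + 3 / (2 * z\<^sup>2)"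
  have L: "L \<ge> 0" "L' \<ge> 0" using assms by (simp_all add: L_def L'_def)
  define C where "C = z * sqrt (8 * K) * (L / (z * sqrt z) + L' * (2 / sqrt z))"
  show ?thesis
  proof (rule that[of C])
    show "C \<ge> 0" using K(1) L assms by (simp add: C_def)
    fix k t :: real assume "k \<noteq> 0" "t \<ge> z"
    define c where "c = k\<^sup>2 / 4"
    have "c > 0" using \<open>k \<noteq> 0\<close> by (simp add: c_def)
    define q where "q = (\<lambda>\<tau>. \<tau>\<^sup>2 - z\<^sup>2)"
    define B where "B = (\<lambda>\<tau>. q \<tau> * bessel_clifford 1 (q \<tau> * c))"
    \<comment> \<open>Dividing the sine by \<open>\<tau>\<close> compensates the inner derivative
      \<open>2 * \<tau>\<close> of \<open>q\<close> in the first integration by parts;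
      \<open>h\<close> is f' divided by \<open>2 * \<tau>\<close> for the same reason in the
      second.\<close>
    define f where "f = (\<lambda>\<tau>. sin (\<omega> * (t - \<tau>)) * inverse \<tau>)"
    define f' where "f' = (\<lambda>\<tau>. - \<omega> * cos (\<omega> * (t - \<tau>)) * inverse \<tau> - sin (\<omega> * (t - \<tau>)) * (inverse \<tau>)\<^sup>2)"
    define h where "h = (\<lambda>\<tau>. f' \<tau> * inverse \<tau> / 2)"
    define h' where "h' = (\<lambda>\<tau>. - \<omega>\<^sup>2 * sin (\<omega> * (t - \<tau>)) * (inverse \<tau>)\<^sup>2 / 2
      + 3 * \<omega> * cos (\<omega> * (t - \<tau>)) * inverse \<tau> ^ 3 / 2 + 3 * sin (\<omega> * (t - \<tau>)) * inverse \<tau> ^ 4 / 2)"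
    define \<kappa> where "\<kappa> = sqrt (8 * K) * \<bar>k\<bar> powr (- 3 / 2)"
    have "\<kappa> \<ge> 0" using K(1) by (simp add: \<kappa>_def)
    have B_le: "\<bar>B \<tau>\<bar> \<le> \<kappa> * sqrt \<tau>" if "\<tau> \<ge> z" for \<tau>
    proof (cases "\<tau> = z")
      case True
      then show ?thesis using \<open>\<kappa> \<ge> 0\<close> \<open>z > 0\<close> by (simp add: B_def q_def)
    next
      case False
      have "\<tau> > 0" using that \<open>z > 0\<close> by simp
      have "q \<tau> > 0" using False that \<open>z > 0\<close> by (simp add: q_def power_strict_mono)
      define s where "s = sqrt (q \<tau>)"
      have s: "s > 0" "q \<tau> = s\<^sup>2" using \<open>q \<tau> > 0\<close> by (simp_all add: s_def)
      have "s \<le> \<tau>" using \<open>\<tau> > 0\<close> by (simp add: s_def q_def real_le_lsqrt)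
      \<comment> \<open>The decay bound is applied at half the Bessel argument |k| s; its cube is
        the source of the 8 in \<open>\<kappa>\<close>.\<close>
      have "(\<bar>k\<bar> * s / 2) ^ 3 * (bessel_clifford 1 ((\<bar>k\<bar> * s / 2)\<^sup>2))\<^sup>2 \<le> K"
        using K(2)[of "\<bar>k\<bar> * s / 2"] \<open>k \<noteq> 0\<close> s by simp
      moreover have "(\<bar>k\<bar> * s / 2)\<^sup>2 = q \<tau> * c"
        by (simp add: s c_def power_mult_distrib power_divide)
      ultimately have *: "s ^ 3 * (bessel_clifford 1 (q \<tau> * c))\<^sup>2 \<le> 8 * K / \<bar>k\<bar> ^ 3"
        using \<open>k \<noteq> 0\<close> by (simp add: power_mult_distrib power_divide field_simps)
      have "(B \<tau>)\<^sup>2 = s * (s ^ 3 * (bessel_clifford 1 (q \<tau> * c))\<^sup>2)"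
        by (simp add: B_def s power_mult_distrib power2_eq_square power3_eq_cube)
      also have "\<dots> \<le> \<tau> * (8 * K / \<bar>k\<bar> ^ 3)"
        using * \<open>s \<le> \<tau>\<close> s by (intro mult_mono) auto
      also have "\<dots> = (\<kappa> * sqrt \<tau>)\<^sup>2"
      proof -
        have "(\<bar>k\<bar> powr (- 3 / 2))\<^sup>2 = \<bar>k\<bar> powr (- 3)"
          by (simp add: power2_eq_square flip: powr_add)
        also have "\<dots> = 1 / \<bar>k\<bar> ^ 3"
          using \<open>k \<noteq> 0\<close> by (simp add: powr_minus powr_numeral divide_inverse)
        finally show ?thesis
          using K(1) \<open>\<tau> > 0\<close> by (simp add: \<kappa>_def power_mult_distrib)
      qed
      finally show ?thesis
        using \<open>\<kappa> \<ge> 0\<close> \<open>\<tau> > 0\<close> by (auto intro: power2_le_imp_le[of "\<bar>B \<tau>\<bar>"])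
    qed
    have mult_le: "\<bar>x * y\<bar> \<le> a" if "\<bar>x\<bar> \<le> a" "\<bar>y\<bar> \<le> 1" for x y a :: real
      using mult_mono[OF that] that by (simp add: abs_mult)
    have h_le: "\<bar>h \<tau>\<bar> \<le> L / \<tau>\<^sup>2" if "\<tau> \<ge> z" for \<tau>
    proof -
      have "\<tau> > 0" using that \<open>z > 0\<close> by simp
      have "h \<tau> = - (\<omega> / 2 * cos (\<omega> * (t - \<tau>)) + 1 / (2 * \<tau>) * sin (\<omega> * (t - \<tau>))) / \<tau>\<^sup>2"
        using \<open>\<tau> > 0\<close> by (simp add: h_def f'_def field_simps power2_eq_square)
      moreover have "\<bar>\<omega> / 2 * cos (\<omega> * (t - \<tau>)) + 1 / (2 * \<tau>) * sin (\<omega> * (t - \<tau>))\<bar> \<le> L"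
      proof -
        have "\<bar>\<omega> / 2 * cos (\<omega> * (t - \<tau>))\<bar> \<le> \<omega> / 2"
          by (rule mult_le) (use assms in auto)
        moreover have "\<bar>1 / (2 * \<tau>) * sin (\<omega> * (t - \<tau>))\<bar> \<le> 1 / (2 * z)"
          by (rule mult_le) (use assms that in \<open>auto simp: field_simps\<close>)
        ultimately show ?thesis unfolding L_def by linarith
      qed
      ultimately show ?thesis using \<open>\<tau> > 0\<close> by (simp add: divide_right_mono)
    qed
    have h'_le: "\<bar>h' \<tau>\<bar> \<le> L' / \<tau>\<^sup>2" if "\<tau> \<ge> z" for \<tau>
    proof -
      have "\<tau> > 0" using that \<open>z > 0\<close> by simp
      have "h' \<tau> = (- (\<omega>\<^sup>2 / 2) * sin (\<omega> * (t - \<tau>)) + 3 * \<omega> / (2 * \<tau>) * cos (\<omega> * (t - \<tau>))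
          + 3 / (2 * \<tau>\<^sup>2) * sin (\<omega> * (t - \<tau>))) / \<tau>\<^sup>2"
        using \<open>\<tau> > 0\<close> by (simp add: h'_def field_simps power2_eq_square power3_eq_cube power4_eq_xxxx)
      moreover
      have "z\<^sup>2 \<le> \<tau>\<^sup>2" using that \<open>z > 0\<close> by (intro power_mono) auto
      have "\<bar>- (\<omega>\<^sup>2 / 2) * sin (\<omega> * (t - \<tau>)) + 3 * \<omega> / (2 * \<tau>) * cos (\<omega> * (t - \<tau>))
          + 3 / (2 * \<tau>\<^sup>2) * sin (\<omega> * (t - \<tau>))\<bar> \<le> L'"
      proof -
        have "\<bar>- (\<omega>\<^sup>2 / 2) * sin (\<omega> * (t - \<tau>))\<bar> \<le> \<omega>\<^sup>2 / 2"
          by (rule mult_le) auto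
        moreover have "\<bar>3 * \<omega> / (2 * \<tau>) * cos (\<omega> * (t - \<tau>))\<bar> \<le> 3 * \<omega> / (2 * z)"
          by (rule mult_le) (use assms that in \<open>auto simp: field_simps\<close>)
        moreover have "\<bar>3 / (2 * \<tau>\<^sup>2) * sin (\<omega> * (t - \<tau>))\<bar> \<le> 3 / (2 * z\<^sup>2)"
          by (rule mult_le) (use assms \<open>\<tau> > 0\<close> \<open>z\<^sup>2 \<le> \<tau>\<^sup>2\<close> in \<open>auto simp: field_simps\<close>)
        ultimately show ?thesis unfolding L'_def by linarith
      qed
      ultimately show ?thesis using \<open>\<tau> > 0\<close> by (simp add: divide_right_mono)
    qed
    \<comment> \<open>\<open>\<Phi>\<close> collects the boundary terms of both integrations by
      parts; in its derivative the two terms that contain J_0 cancel.\<close>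
    define \<Phi> where "\<Phi> = (\<lambda>\<tau>. bessel_clifford 0 (q \<tau> * c) * f \<tau> - B \<tau> * h \<tau>)"
    define S where "S = (\<lambda>\<tau>. c * bessel_clifford 1 (q \<tau> * c) * sin (\<omega> * (t - \<tau>)))"
    have "(\<Phi> has_vector_derivative - 2 * S \<tau> - B \<tau> * h' \<tau>) (at \<tau> within {z..t})" if "\<tau> \<in> {z..t}" for \<tau>
    proof -
      have "\<tau> > 0" using that \<open>z > 0\<close> by simp
      have dq: "(q has_field_derivative 2 * \<tau>) (at \<tau>)"
        unfolding q_def by (auto intro!: derivative_eq_intros)
      have da: "((\<lambda>\<tau>. bessel_clifford 0 (q \<tau> * c)) has_field_derivative
          - bessel_clifford 1 (q \<tau> * c) * (2 * \<tau> * c)) (at \<tau>)"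
        by (intro DERIV_bessel_clifford_0 DERIV_cmult_right dq)
      have dB: "(B has_field_derivative bessel_clifford 0 (q \<tau> * c) * (2 * \<tau>)) (at \<tau>)"
        unfolding B_def by (rule DERIV_mult_bessel_clifford_1[OF dq])
      have df: "(f has_field_derivative f' \<tau>) (at \<tau>)"
        unfolding f_def f'_def using \<open>\<tau> > 0\<close>
        by (auto intro!: derivative_eq_intros simp: algebra_simps power2_eq_square)
      have dh: "(h has_field_derivative h' \<tau>) (at \<tau>)"
        unfolding h_def f'_def h'_def using \<open>\<tau> > 0\<close>
        by (auto intro!: derivative_eq_intros)
           (simp add: algebra_simps power2_eq_square power3_eq_cube power4_eq_xxxx)
      have sin_eq: "sin (\<omega> * (t - \<tau>)) = f \<tau> * \<tau>" and f'_eq: "f' \<tau> = h \<tau> * (2 * \<tau>)"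
        using \<open>\<tau> > 0\<close> by (simp_all add: f_def h_def)
      have "- 2 * S \<tau> - B \<tau> * h' \<tau> =
          (bessel_clifford 0 (q \<tau> * c) * f' \<tau> + - bessel_clifford 1 (q \<tau> * c) * (2 * \<tau> * c) * f \<tau>) -
          (B \<tau> * h' \<tau> + bessel_clifford 0 (q \<tau> * c) * (2 * \<tau>) * h \<tau>)"
        unfolding S_def sin_eq f'_eq by (simp add: algebra_simps)
      then have "(\<Phi> has_field_derivative - 2 * S \<tau> - B \<tau> * h' \<tau>) (at \<tau>)"
        unfolding \<Phi>_def by (simp only:) (intro DERIV_diff DERIV_mult' da df dB dh)
      then show ?thesis
        by (simp add: has_real_derivative_iff_has_vector_derivative has_vector_derivative_at_within)
    qed
    then have I1: "((\<lambda>\<tau>. - 2 * S \<tau> - B \<tau> * h' \<tau>) has_integral \<Phi> t - \<Phi> z) {z..t}"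
      using \<open>t \<ge> z\<close> by (intro fundamental_theorem_of_calculus) auto
    have "continuous_on {z..t} (\<lambda>\<tau>. B \<tau> * h' \<tau>)"
      unfolding B_def q_def h'_def using \<open>z > 0\<close> by (intro continuous_intros) auto
    then have int_Bh: "(\<lambda>\<tau>. B \<tau> * h' \<tau>) integrable_on {z..t}"
      by (rule integrable_continuous_interval)
    from has_integral_add[OF I1 integrable_integral[OF this]]
    have "((\<lambda>\<tau>. - 2 * S \<tau>) has_integral \<Phi> t - \<Phi> z + integral {z..t} (\<lambda>\<tau>. B \<tau> * h' \<tau>)) {z..t}"
      by simp
    then have "- 2 * integral {z..t} S = \<Phi> t - \<Phi> z + integral {z..t} (\<lambda>\<tau>. B \<tau> * h' \<tau>)"
      by (metis integral_mult_right integral_unique)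
    then have "z * (- 2 * integral {z..t} S) = z * \<Phi> t - z * \<Phi> z + z * integral {z..t} (\<lambda>\<tau>. B \<tau> * h' \<tau>)"
      by (simp only: distrib_left right_diff_distrib)
    moreover have "mode_response \<omega> k z t = sin (\<omega> * (t - z)) + z * (- 2 * integral {z..t} S)"
      by (simp add: mode_response_def S_def q_def c_def mult_ac)
    \<comment> \<open>At t the sine in \<open>f\<close> is 0; at z both \<open>q\<close> and
      \<open>B\<close> are 0 and the Bessel factor is 1. Thus \<open>z * \<Phi> z\<close> is exactly
      the free sine of the response, and every remaining term carries \<open>B\<close>.\<close>
    moreover have "\<Phi> t = - B t * h t" "z * \<Phi> z = sin (\<omega> * (t - z))"
      using \<open>z > 0\<close> by (simp_all add: \<Phi>_def f_def B_def q_def bessel_clifford_0_at_0)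
    ultimately have eq: "mode_response \<omega> k z t = z * (integral {z..t} (\<lambda>\<tau>. B \<tau> * h' \<tau>) - B t * h t)"
      by (simp only: right_diff_distrib)
    have sq_eq: "sqrt \<tau> / \<tau>\<^sup>2 = 1 / (\<tau> * sqrt \<tau>)" if "\<tau> \<ge> z" for \<tau>
    proof -
      have "\<tau> > 0" using that \<open>z > 0\<close> by simp
      then have "sqrt \<tau> * sqrt \<tau> = \<tau>" by simp
      then show ?thesis using \<open>\<tau> > 0\<close> by (simp add: field_simps power2_eq_square)
    qed
    have prod_le: "\<bar>B \<tau> * y\<bar> \<le> \<kappa> * l * (1 / (\<tau> * sqrt \<tau>))" if "\<tau> \<ge> z" "\<bar>y\<bar> \<le> l / \<tau>\<^sup>2" for \<tau> y l
    proof -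
      have "\<bar>B \<tau> * y\<bar> \<le> (\<kappa> * sqrt \<tau>) * (l / \<tau>\<^sup>2)"
        unfolding abs_mult using B_le[OF that(1)] that \<open>z > 0\<close> \<open>\<kappa> \<ge> 0\<close> by (intro mult_mono) auto
      also have "\<dots> = \<kappa> * l * (sqrt \<tau> / \<tau>\<^sup>2)" by simp
      finally show ?thesis using sq_eq[OF that(1)] by simp
    qed
    have "\<bar>B t * h t\<bar> \<le> \<kappa> * L * (1 / (t * sqrt t))"
      using prod_le h_le \<open>t \<ge> z\<close> by blast
    also have "\<dots> \<le> \<kappa> * L * (1 / (z * sqrt z))"
      using \<open>t \<ge> z\<close> \<open>z > 0\<close> \<open>\<kappa> \<ge> 0\<close> L by (intro mult_left_mono divide_left_mono mult_mono) auto
    finally have b1: "\<bar>B t * h t\<bar> \<le> \<kappa> * (L / (z * sqrt z))" by simp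
    have "((\<lambda>\<tau>. 1 / (\<tau> * sqrt \<tau>)) has_integral (- 2 / sqrt t) - (- 2 / sqrt z)) {z..t}"
    proof (rule fundamental_theorem_of_calculus[OF \<open>t \<ge> z\<close>])
      fix \<tau> assume "\<tau> \<in> {z..t}"
      then have "\<tau> > 0" using \<open>z > 0\<close> by simp
      then have "((\<lambda>\<tau>. - 2 / sqrt \<tau>) has_field_derivative 1 / (\<tau> * sqrt \<tau>)) (at \<tau>)"
        by (auto intro!: derivative_eq_intros simp: field_simps)
      then show "((\<lambda>\<tau>. - 2 / sqrt \<tau>) has_vector_derivative 1 / (\<tau> * sqrt \<tau>)) (at \<tau> within {z..t})"
        by (simp add: has_real_derivative_iff_has_vector_derivative has_vector_derivative_at_within)
    qed
    then have I2: "((\<lambda>\<tau>. \<kappa> * L' * (1 / (\<tau> * sqrt \<tau>))) has_integral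
        \<kappa> * L' * ((- 2 / sqrt t) - (- 2 / sqrt z))) {z..t}"
      by (rule has_integral_mult_right)
    have "norm (integral {z..t} (\<lambda>\<tau>. B \<tau> * h' \<tau>)) \<le> integral {z..t} (\<lambda>\<tau>. \<kappa> * L' * (1 / (\<tau> * sqrt \<tau>)))"
    proof (rule integral_norm_bound_integral[OF int_Bh])
      show "(\<lambda>\<tau>. \<kappa> * L' * (1 / (\<tau> * sqrt \<tau>))) integrable_on {z..t}" using I2 by blast
    qed (use prod_le h'_le in auto)
    also have "\<dots> = \<kappa> * L' * ((- 2 / sqrt t) - (- 2 / sqrt z))"
      using I2 by (rule integral_unique)
    also have "\<dots> \<le> \<kappa> * L' * (2 / sqrt z)"
      using \<open>\<kappa> \<ge> 0\<close> L \<open>z > 0\<close> \<open>t \<ge> z\<close> by (intro mult_left_mono) auto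
    finally have b2: "\<bar>integral {z..t} (\<lambda>\<tau>. B \<tau> * h' \<tau>)\<bar> \<le> \<kappa> * (L' * (2 / sqrt z))" by simp
    have "\<bar>mode_response \<omega> k z t\<bar> = z * \<bar>integral {z..t} (\<lambda>\<tau>. B \<tau> * h' \<tau>) - B t * h t\<bar>"
      unfolding eq using \<open>z > 0\<close> by (simp add: abs_mult)
    also have "\<dots> \<le> z * (\<kappa> * (L' * (2 / sqrt z)) + \<kappa> * (L / (z * sqrt z)))"
      using b1 b2 \<open>z > 0\<close> by (intro mult_left_mono) auto
    also have "\<dots> = C * \<bar>k\<bar> powr (- 3 / 2)"
      by (simp add: C_def \<kappa>_def algebra_simps)
    finally show "\<bar>mode_response \<omega> k z t\<bar> \<le> C * \<bar>k\<bar> powr (- 3 / 2)" .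
  qed
qed

section \<open>Exchange of limit and series, and summable majorants\<close>

text \<open>By the Weierstrass test the finite partial sums converge uniformly on Y, and each of
  them tends to 0, so the limits may be exchanged. The bound is restricted to Y because the modes
  are controlled for t \<ge> z.\<close>

lemma infsum_tendsto_0_dominated:
  fixes f :: "'a \<Rightarrow> 'b \<Rightarrow> 'c :: banach"
  assumes bound: "\<And>x t. x \<in> X \<Longrightarrow> t \<in> Y \<Longrightarrow> norm (f x t) \<le> M x" and "M summable_on X"
    and lim: "\<And>x. x \<in> X \<Longrightarrow> (f x \<longlongrightarrow> 0) F" and ev: "\<forall>\<^sub>F t in F. t \<in> Y"
  shows "((\<lambda>t. \<Sum>\<^sub>\<infinity>x\<in>X. f x t) \<longlongrightarrow> 0) F"
proof (rule swap_uniform_limit'[OF _ tendsto_const Weierstrass_m_test_general ev])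
  show "\<forall>\<^sub>F A in finite_subsets_at_top X. ((\<lambda>t. \<Sum>x\<in>A. f x t) \<longlongrightarrow> 0) F"
  proof (rule eventually_mono)
    show "\<forall>\<^sub>F A in finite_subsets_at_top X. finite A \<and> A \<subseteq> X"
      by (intro eventually_finite_subsets_at_top_weakI) auto
    fix A assume "finite A \<and> A \<subseteq> X"
    then show "((\<lambda>t. \<Sum>x\<in>A. f x t) \<longlongrightarrow> 0) F"
      using lim by (intro tendsto_null_sum) auto
  qed
qed (use assms in auto)

lemma summable_on_int_powr:
  assumes "s < - 1"
  shows "(\<lambda>n. \<bar>real_of_int n\<bar> powr s) summable_on UNIV"
proof -
  have nat: "(\<lambda>n. real n powr s) summable_on UNIV"
    using assms by (simp add: summable_on_UNIV_nonneg_real_iff summable_real_powr_iff)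
  have "(\<lambda>n. \<bar>real_of_int n\<bar> powr s) summable_on range int"
    using nat by (subst summable_on_reindex) (auto simp: o_def)
  moreover have "(\<lambda>n. \<bar>real_of_int n\<bar> powr s) summable_on range (\<lambda>n. - int n)"
    using nat by (subst summable_on_reindex) (auto simp: o_def inj_on_def)
  moreover have "range int \<union> range (\<lambda>n. - int n) = UNIV"
  proof -
    have "m \<in> range int \<union> range (\<lambda>n. - int n)" for m
      by (cases m rule: int_cases2) auto
    then show ?thesis by blast
  qed
  ultimately show ?thesis by (metis summable_on_union)
qed

text \<open>A bound uniform in n is enough, since summability over n comes from the modes.\<close>

lemma abs_cos_coeff_le:
  assumes "d > 0" "g absolutely_integrable_on {0..d}"
  shows "\<bar>cos_coeff d g n\<bar> \<le> 2 / d * integral {0..d/2} (\<lambda>x. \<bar>g x\<bar>)"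
proof -
  have "g absolutely_integrable_on {0..d/2}"
    using assms by (intro absolutely_integrable_on_subinterval[OF assms(2)]) auto
  then have int: "(\<lambda>x. \<bar>g x\<bar>) integrable_on {0..d/2}"
    by (simp add: absolutely_integrable_on_def)
  have "\<bar>integral {0..d/2} (\<lambda>x. g x * cos (wavenumber d n * x))\<bar> \<le> integral {0..d/2} (\<lambda>x. \<bar>g x\<bar>)"
  proof (cases "(\<lambda>x. g x * cos (wavenumber d n * x)) integrable_on {0..d/2}")
    case True
    have "norm (g x * cos (wavenumber d n * x)) \<le> \<bar>g x\<bar>" for x
      by (simp add: abs_mult mult_left_le)
    with integral_norm_bound_integral[OF True int] show ?thesis by simp
  next
    case False
    then show ?thesis
      \<comment> \<open>The integral on the left is 0 by default here.\<close>
      using integral_nonneg[OF int] by (simp add: not_integrable_integral)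
  qed
  then show ?thesis
    using \<open>d > 0\<close> by (simp add: cos_coeff_def abs_mult divide_right_mono)
qed

text \<open>The exponential decay in k is weakened to a summable power. If
  \<open>k\<^sup>2 \<le> 2 * \<omega>\<^sup>2\<close>, the right side is at least 1. Otherwise
  \<open>k\<^sup>2 - \<omega>\<^sup>2\<close> is at least \<open>k\<^sup>2 / 2\<close>, and
  \<open>exp s \<ge> s\<^sup>2 / 2\<close> gives the term \<open>4 / z\<^sup>2\<close>.\<close>

lemma norm_helmholtz_factor_le:
  assumes "\<omega> > 0" "z > 0"
  shows "norm (helmholtz_factor \<omega> k z) \<le> 1"
    and "k \<noteq> 0 \<Longrightarrow> norm (helmholtz_factor \<omega> k z) \<le> (2 * \<omega>\<^sup>2 + 4 / z\<^sup>2) / k\<^sup>2"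
proof -
  have k2: "\<omega>\<^sup>2 < k\<^sup>2" if "\<not> \<bar>k\<bar> \<le> \<omega>"
    using power_strict_mono[of \<omega> "\<bar>k\<bar>" 2] that \<open>\<omega> > 0\<close> by simp
  show le1: "norm (helmholtz_factor \<omega> k z) \<le> 1"
    using k2 \<open>z > 0\<close> by (auto simp: helmholtz_factor_def)
  assume "k \<noteq> 0"
  show "norm (helmholtz_factor \<omega> k z) \<le> (2 * \<omega>\<^sup>2 + 4 / z\<^sup>2) / k\<^sup>2"
  proof (cases "k\<^sup>2 \<le> 2 * \<omega>\<^sup>2")
    case True
    have "k\<^sup>2 \<le> 2 * \<omega>\<^sup>2 + 4 / z\<^sup>2" using True by (intro add_increasing2) auto
    then have "1 \<le> (2 * \<omega>\<^sup>2 + 4 / z\<^sup>2) / k\<^sup>2" using \<open>k \<noteq> 0\<close> by (simp add: divide_simps)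
    with le1 show ?thesis by simp
  next
    case False
    define s where "s = z * sqrt (k\<^sup>2 - \<omega>\<^sup>2)"
    have "\<not> \<bar>k\<bar> \<le> \<omega>"
    proof
      assume "\<bar>k\<bar> \<le> \<omega>"
      then have "k\<^sup>2 \<le> \<omega>\<^sup>2" using power_mono[of "\<bar>k\<bar>" \<omega> 2] by simp
      with False zero_le_power2[of \<omega>] show False by linarith
    qed
    with k2 have "s > 0" "s\<^sup>2 = z\<^sup>2 * (k\<^sup>2 - \<omega>\<^sup>2)"
      using \<open>z > 0\<close> by (simp_all add: s_def power_mult_distrib)
    moreover have "z\<^sup>2 * (k\<^sup>2 / 2) \<le> z\<^sup>2 * (k\<^sup>2 - \<omega>\<^sup>2)"
      using False by (intro mult_left_mono) auto
    ultimately have "z\<^sup>2 * k\<^sup>2 / 4 \<le> s\<^sup>2 / 2" by (simp add: mult.commute)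
    also have "\<dots> \<le> exp s" using exp_lower_Taylor_quadratic[of s] \<open>s > 0\<close> by simp
    finally have "z\<^sup>2 * k\<^sup>2 / 4 \<le> exp s" .
    then have "inverse (exp s) \<le> inverse (z\<^sup>2 * k\<^sup>2 / 4)"
      using \<open>z > 0\<close> \<open>k \<noteq> 0\<close> by (intro le_imp_inverse_le) auto
    then have "exp (- s) \<le> 4 / z\<^sup>2 / k\<^sup>2"
      by (simp add: exp_minus field_simps)
    also have "\<dots> \<le> (2 * \<omega>\<^sup>2 + 4 / z\<^sup>2) / k\<^sup>2" by (intro divide_right_mono) auto
    finally show ?thesis
      using \<open>\<not> \<bar>k\<bar> \<le> \<omega>\<close> by (simp add: helmholtz_factor_def s_def)
  qed
qed

lemma mode_bounds:
  assumes "d > 0" "\<omega> > 0" "z > 0"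
  obtains M where "M summable_on UNIV"
    "\<And>n t. t \<ge> z \<Longrightarrow> \<bar>mode_response \<omega> (wavenumber d n) z t\<bar> \<le> M n"
    "\<And>n. norm (helmholtz_factor \<omega> (wavenumber d n) z) \<le> M n"
proof -
  obtain C where C: "C \<ge> 0"
    "\<And>k t. k \<noteq> 0 \<Longrightarrow> t \<ge> z \<Longrightarrow> \<bar>mode_response \<omega> k z t\<bar> \<le> C * \<bar>k\<bar> powr (- 3 / 2)"
    by (rule mode_response_bound[OF assms(2,3)]) blast
  define D where "D = 2 * \<omega>\<^sup>2 + 4 / z\<^sup>2"
  have "D \<ge> 0" by (simp add: D_def)
  define A where "A = C * (2 * pi / d) powr (- 3 / 2)"
  define B where "B = D / (2 * pi / d)\<^sup>2"
  define p where "p = (\<lambda>n. \<bar>real_of_int n\<bar> powr (- 3 / 2))"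
  \<comment> \<open>Since \<open>0 powr (- 3 / 2)\<close> is 0, the extra 1 covers the mode n = 0,
    whose response is a pure sine. For other n, |n|^(-2) is at most |n|^(-3/2), so one power serves
    both bounds.\<close>
  define M where "M = (\<lambda>n. (A + B) * p n + (if n = 0 then 1 else 0))"
  have AB: "A \<ge> 0" "B \<ge> 0" using C(1) \<open>D \<ge> 0\<close> by (simp_all add: A_def B_def)
  have le_M: "a * p n \<le> M n" if "a \<le> A + B" for a n
    using that by (simp add: M_def p_def mult_right_mono add_increasing2)
  show thesis
  proof (rule that[of M])
    show "M summable_on UNIV"
      unfolding M_def p_def
      by (intro summable_on_add summable_on_cmult_right summable_on_int_powr
          finite_nonzero_values_imp_summable_on) auto
    show "\<bar>mode_response \<omega> (wavenumber d n) z t\<bar> \<le> M n" if "t \<ge> z" for n t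
    proof (cases "n = 0")
      case True
      then show ?thesis by (simp add: M_def p_def wavenumber_def mode_response_def)
    next
      case False
      then have "\<bar>mode_response \<omega> (wavenumber d n) z t\<bar> \<le> C * \<bar>wavenumber d n\<bar> powr (- 3 / 2)"
        using \<open>d > 0\<close> by (intro C(2) that) (simp add: wavenumber_def)
      also have "\<dots> = A * p n"
        using \<open>d > 0\<close> by (simp add: wavenumber_def A_def p_def abs_mult flip: powr_mult)
      also have "\<dots> \<le> M n" using AB by (intro le_M) auto
      finally show ?thesis .
    qed
    show "norm (helmholtz_factor \<omega> (wavenumber d n) z) \<le> M n" for n
    proof (cases "n = 0")
      case True
      then show ?thesis
        using norm_helmholtz_factor_le(1)[OF assms(2,3)] by (simp add: M_def p_def)
    next
      case False
      then have "norm (helmholtz_factor \<omega> (wavenumber d n) z) \<le> D / (wavenumber d n)\<^sup>2"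
        unfolding D_def using \<open>d > 0\<close>
        by (intro norm_helmholtz_factor_le(2) assms) (simp add: wavenumber_def)
      also have "\<dots> = B * (1 / (of_int n)\<^sup>2)"
        by (simp add: B_def wavenumber_def power_mult_distrib power_divide)
      also have "1 / (of_int n)\<^sup>2 = \<bar>real_of_int n\<bar> powr (- 2)"
        using False by (simp add: powr_minus powr_numeral divide_inverse)
      also have "B * \<bar>real_of_int n\<bar> powr (- 2) \<le> B * p n"
        unfolding p_def using False AB by (intro mult_left_mono powr_mono) auto
      also have "\<dots> \<le> M n" using AB by (intro le_M) auto
      finally show ?thesis .
    qed
  qed
qed

section \<open>Termwise passage to the limit\<close>

theorem theorem1:
  fixes d \<omega> :: real and g :: "real \<Rightarrow> real"
  assumes "d > 0" and "\<omega> > 0"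
    and "\<And>x. g (- x) = g x"
    and "\<And>x. g (x + d) = g x"
    and "g absolutely_integrable_on {0..d}"
  shows "\<forall>x z. z > 0 \<longrightarrow>
    ((\<lambda>t. wave_sol d \<omega> g t x z - Im (helmholtz_sol d \<omega> g x z * exp (\<i> * of_real (\<omega> * t))))
       \<longlongrightarrow> 0) at_top"
proof (intro allI impI)
  fix x z :: real assume "z > 0"
  obtain M where M: "M summable_on UNIV"
    "\<And>n t. t \<ge> z \<Longrightarrow> \<bar>mode_response \<omega> (wavenumber d n) z t\<bar> \<le> M n"
    "\<And>n. norm (helmholtz_factor \<omega> (wavenumber d n) z) \<le> M n"
    using mode_bounds[OF assms(1,2) \<open>z > 0\<close>] by blast
  define G where "G = 2 / d * integral {0..d/2} (\<lambda>x. \<bar>g x\<bar>)"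
  define a where "a = (\<lambda>n. cos_coeff d g n * cos (wavenumber d n * x))"
  define R where "R = (\<lambda>n. mode_response \<omega> (wavenumber d n) z)"
  define H where "H = (\<lambda>n. helmholtz_factor \<omega> (wavenumber d n) z)"
  define E where "E = (\<lambda>t. exp (\<i> * of_real (\<omega> * t)))"
  have norm_E: "norm (E t) = 1" for t by (simp add: E_def)
  have a_le: "\<bar>a n\<bar> \<le> G" for n
  proof -
    have "\<bar>a n\<bar> \<le> \<bar>cos_coeff d g n\<bar>" by (simp add: a_def abs_mult mult_left_le)
    with abs_cos_coeff_le[OF assms(1,5), of n] show ?thesis unfolding G_def by linarith
  qed
  have "G \<ge> 0" using a_le[of 0] by linarith
  have GM: "(\<lambda>n. c * (G * M n)) summable_on UNIV" for c
    by (intro summable_on_cmult_right M(1))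
  have aR_le: "norm (a n * R n t) \<le> G * M n" if "t \<ge> z" for n t
    unfolding real_norm_def abs_mult R_def by (intro mult_mono a_le M(2) that \<open>G \<ge> 0\<close>) auto
  have aH_le: "norm (of_real (a n) * H n * E t) \<le> G * M n" for n t
    unfolding norm_mult norm_of_real H_def norm_E mult_1_right
    by (intro mult_mono a_le M(3) \<open>G \<ge> 0\<close>) auto
  have aImH_le: "norm (a n * Im (H n * E t)) \<le> G * M n" for n t
    using abs_Im_le_cmod[of "of_real (a n) * H n * E t"] aH_le[of n t] by (simp add: mult.assoc)
  have "((\<lambda>t. \<Sum>\<^sub>\<infinity>n\<in>UNIV. a n * (R n t - Im (H n * E t))) \<longlongrightarrow> 0) at_top"
  proof (rule infsum_tendsto_0_dominated[where Y = "{z..}"])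
    show "(\<lambda>n. 2 * (G * M n)) summable_on UNIV" by (rule GM)
    show "norm (a n * (R n t - Im (H n * E t))) \<le> 2 * (G * M n)" if "t \<in> {z..}" for n t
      using norm_triangle_ineq4[of "a n * R n t" "a n * Im (H n * E t)"] aR_le[of t n] aImH_le[of n t] that
      by (simp add: right_diff_distrib)
    show "((\<lambda>t. a n * (R n t - Im (H n * E t))) \<longlongrightarrow> 0) at_top" for n
    proof (rule tendsto_mult_right_zero)
      define k where "k = wavenumber d n"
      define T where "T = (\<lambda>t. mode_transfer \<i> (- 1) (k\<^sup>2 - \<omega>\<^sup>2) z t \<omega>)"
      have "((\<lambda>t. T t - H n) \<longlongrightarrow> 0) at_top"
        using mode_transfer_tendsto[OF assms(2) \<open>z > 0\<close>, of k]
        by (simp add: T_def H_def k_def LIM_zero_iff)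
      then have lim: "((\<lambda>t. norm (T t - H n)) \<longlongrightarrow> 0) at_top" by (rule tendsto_norm_zero)
      \<comment> \<open>\<open>E t\<close> oscillates but has modulus 1, and the imaginary part does
        not exceed the modulus; so the convergence of \<open>T t\<close> to \<open>H n\<close>
        suffices.\<close>
      have le: "norm (R n t - Im (H n * E t)) \<le> norm (T t - H n)" for t
      proof -
        have "R n t - Im (H n * E t) = Im (E t * (T t - H n))"
          by (simp add: R_def mode_response_eq_transfer E_def T_def k_def algebra_simps)
        then show ?thesis
          using abs_Im_le_cmod[of "E t * (T t - H n)"] by (simp add: norm_mult norm_E)
      qed
      show "((\<lambda>t. R n t - Im (H n * E t)) \<longlongrightarrow> 0) at_top"
        by (rule Lim_null_comparison[OF always_eventually[OF allI] lim]) (rule le)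
    qed
  qed (simp add: eventually_ge_at_top)
  \<comment> \<open>An infinite sum that does not exist is 0 by default, so both series are shown to
    be summable before they are subtracted. For t \<ge> z the Heaviside factor is 1.\<close>
  moreover have "\<forall>\<^sub>F t in at_top. (\<Sum>\<^sub>\<infinity>n\<in>UNIV. a n * (R n t - Im (H n * E t))) =
      wave_sol d \<omega> g t x z - Im (helmholtz_sol d \<omega> g x z * exp (\<i> * of_real (\<omega> * t)))"
    using eventually_ge_at_top[of z]
  proof eventually_elim
    case (elim t)
    have "(\<lambda>n. a n * R n t) summable_on UNIV"
      by (rule Infinite_Sum.abs_summable_summable, rule Infinite_Sum.abs_summable_on_comparison_test'[of "\<lambda>n. G * M n"])
         (use GM[of 1] aR_le elim in auto)
    moreover have "wave_sol d \<omega> g t x z = (\<Sum>\<^sub>\<infinity>n\<in>UNIV. a n * R n t)"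
      by (simp add: wave_sol_def wave_term_eq_mode_response[OF \<open>z > 0\<close> elim] a_def R_def)
    ultimately have 1: "((\<lambda>n. a n * R n t) has_sum wave_sol d \<omega> g t x z) UNIV"
      by simp
    have "(\<lambda>n. of_real (a n) * H n * E t) summable_on UNIV"
      by (rule Infinite_Sum.abs_summable_summable, rule Infinite_Sum.abs_summable_on_comparison_test'[of "\<lambda>n. G * M n"])
         (use GM[of 1] aH_le in auto)
    moreover have "helmholtz_sol d \<omega> g x z * E t = (\<Sum>\<^sub>\<infinity>n\<in>UNIV. of_real (a n) * H n * E t)"
      unfolding helmholtz_sol_def infsum_cmult_left' by (simp add: a_def H_def)
    ultimately have "((\<lambda>n. of_real (a n) * H n * E t) has_sum helmholtz_sol d \<omega> g x z * E t) UNIV"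
      by simp
    from has_sum_Im[OF this]
    have 2: "((\<lambda>n. a n * Im (H n * E t)) has_sum Im (helmholtz_sol d \<omega> g x z * E t)) UNIV"
      by (simp add: mult.assoc)
    from has_sum_add[OF 1 has_sum_uminusI[OF 2]] show ?case
      by (intro infsumI) (simp only: diff_conv_add_uminus distrib_left mult_minus_right E_def)
  qed
  ultimately show "((\<lambda>t. wave_sol d \<omega> g t x z - Im (helmholtz_sol d \<omega> g x z * exp (\<i> * of_real (\<omega> * t))))
       \<longlongrightarrow> 0) at_top"
    by (rule Lim_transform_eventually)
qed

end
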